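(* Let $M^2_1$ be a Lorentz surface of general type in $\mathbb{E}^4_2$ with geometric functions $\nu_1,\nu_2,\beta_1,\beta_2$. Then $M^2_1$ has parallel mean curvature vector field (i.e. $DH=0$ identically) if and only if $\beta_1=\beta_2=0$ and $\nu_1-\nu_2$ is constant.
   Context: $\mathbb{E}^4_2$ is $\mathbb{R}^4$ with the standard orientation and the metric $\langle\cdot,\cdot\rangle=dx_1^2+dx_2^2-dx_3^2-dx_4^2$; $\nabla'$ is its Levi-Civita connection. A Lorentz surface $M^2_1:z=z(u,v)$, $(u,v)$ in a (connected) domain of $\mathbb{R}^2$, is a smooth immersed surface whose induced metric has signature $(1,1)$. $\sigma$ is its second fundamental form (normal part of $\nabla'_XY$), $D$ its normal connection (normal part of $\nabla'_X\xi$ for normal $\xi$), and $H=\frac12\operatorname{tr}\sigma=\frac12(\sigma(x,x)-\sigma(y,y))$ for tangent orthonormal $x,y$ with $\langle x,x\rangle=1$, $\langle y,y\rangle=-1$. Write $E=\langle z_u,z_u\rangle>0$, $F=\langle z_u,z_v\rangle$, $G=\langle z_v,z_v\rangle<0$ (parameters are always taken with these signs), $W=\sqrt{|EG-F^2|}$. For a normal frame $n_1,n_2$ with $\langle n_1,n_1\rangle=1$, $\langle n_2,n_2\rangle=-1$, $\langle n_1,n_2\rangle=0$ put $c_{11}^k=\langle z_{uu},n_k\rangle$, $c_{12}^k=\langle z_{uv},n_k\rangle$, $c_{22}^k=\langle z_{vv},n_k\rangle$, $\Delta_1=c_{11}^1c_{12}^2-c_{12}^1c_{11}^2$, $\Delta_2=c_{11}^1c_{22}^2-c_{22}^1c_{11}^2$,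 $\Delta_3=c_{12}^1c_{22}^2-c_{22}^1c_{12}^2$, $L=2\Delta_1/W$, $M=\Delta_2/W$, $N=2\Delta_3/W$, $k=\frac{LN-M^2}{EG-F^2}$, $\varkappa=\frac{EN+GL-2FM}{2(EG-F^2)}$. A Lorentz surface of general type is one that is free of flat points, i.e. $(L,M,N)\ne(0,0,0)$ everywhere, satisfies $\varkappa^2-k>0$ everywhere, and whose mean curvature vector $H$ is at each point non-zero and either spacelike ($\langle H,H\rangle>0$) or timelike ($\langle H,H\rangle<0$). Set $\varepsilon=\operatorname{sign}\langle H,H\rangle$. Parameters are principal if $F=0$ and $M=0$; since $\varkappa^2-k>0$, the surface is assumed parametrized by principal parameters. Put $x=z_u/\sqrt{E}$, $y=z_v/\sqrt{-G}$, $b=\varepsilon H/\sqrt{\varepsilon\langle H,H\rangle}$ (so $\langle b,b\rangle=\varepsilon$), and let $l$ be the normal field with $\langle l,l\rangle=-\varepsilon$, $\langle b,l\rangle=0$, such that $(x,y,b,l)$ is positively oriented if $\varepsilon=1$ and $(x,y,l,b)$ is positively oriented if $\varepsilon=-1$. The geometric functions used here are $\nu_1=\langle\sigma(x,x),b\rangle$, $\nu_2=\langle\sigma(y,y),b\rangle$, $\beta_1=\langle\nabla'_xb,l\rangle$, $\beta_2=\langle\nabla'_yb,l\rangle$. *)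

theory Defs
  imports "HOL-Analysis.Analysis"
begin

section \<open>The ambient space and smooth maps from the parameter plane\<close>

text \<open>The metric of signature (2,2) on R^4, and the standard orientation.\<close>

definition mip :: "real^4 \<Rightarrow> real^4 \<Rightarrow> real" where
  "mip a b = a$1 * b$1 + a$2 * b$2 - a$3 * b$3 - a$4 * b$4"

definition pos_oriented :: "real^4 \<Rightarrow> real^4 \<Rightarrow> real^4 \<Rightarrow> real^4 \<Rightarrow> bool" where
  "pos_oriented a b c d \<longleftrightarrow> det (vector [a, b, c, d] :: real^4^4) > 0"

definition d_u :: "(real \<times> real \<Rightarrow> 'a::real_normed_vector) \<Rightarrow> real \<times> real \<Rightarrow> 'a" where
  "d_u f p = frechet_derivative f (at p) (1, 0)"

definition d_v :: "(real \<times> real \<Rightarrow> 'a::real_normed_vector) \<Rightarrow> real \<times> real \<Rightarrow> 'a" where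
  "d_v f p = frechet_derivative f (at p) (0, 1)"

text \<open>The following two notions are meant for open sets \<open>U\<close> only.\<close>

primrec Ck_on :: "nat \<Rightarrow> (real \<times> real) set \<Rightarrow> (real \<times> real \<Rightarrow> 'a::real_normed_vector) \<Rightarrow> bool" where
  "Ck_on 0 U f \<longleftrightarrow> continuous_on U f"
| "Ck_on (Suc k) U f \<longleftrightarrow>
     (\<forall>p\<in>U. f differentiable (at p)) \<and> Ck_on k U (d_u f) \<and> Ck_on k U (d_v f)"

definition smooth_on :: "(real \<times> real) set \<Rightarrow> (real \<times> real \<Rightarrow> 'a::real_normed_vector) \<Rightarrow> bool" where
  "smooth_on U f \<longleftrightarrow> (\<forall>k. Ck_on k U f)"

section \<open>Surfaces, tangent and normal spaces, connections\<close>

text \<open>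
  A tangent vector field of the surface is represented by its coordinate field
  \<open>X\<close> in the parameter plane; \<open>push z X\<close> is the field itself, along \<open>z\<close>.
  The Levi-Civita connection of the flat ambient metric is the ordinary derivative, so that
  \<open>nabla X Y\<close> differentiates the field \<open>Y\<close> along \<open>z\<close> in the direction of \<open>push z X\<close>.
\<close>

definition push :: "(real \<times> real \<Rightarrow> real^4) \<Rightarrow> (real \<times> real \<Rightarrow> real \<times> real) \<Rightarrow> real \<times> real \<Rightarrow> real^4" where
  "push z X p = frechet_derivative z (at p) (X p)"

definition nabla :: "(real \<times> real \<Rightarrow> real \<times> real) \<Rightarrow> (real \<times> real \<Rightarrow> real^4) \<Rightarrow> real \<times> real \<Rightarrow> real^4" where
  "nabla X Y p = frechet_derivative Y (at p) (X p)"

definition tangent_space :: "(real \<times> real \<Rightarrow> real^4) \<Rightarrow> real \<times> real \<Rightarrow> (real^4) set" where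
  "tangent_space z p = range (frechet_derivative z (at p))"

definition normal_space :: "(real \<times> real \<Rightarrow> real^4) \<Rightarrow> real \<times> real \<Rightarrow> (real^4) set" where
  "normal_space z p = {n. \<forall>t\<in>tangent_space z p. mip n t = 0}"

text \<open>Well defined where the induced metric is non-degenerate.\<close>

definition normal_part :: "(real \<times> real \<Rightarrow> real^4) \<Rightarrow> real \<times> real \<Rightarrow> real^4 \<Rightarrow> real^4" where
  "normal_part z p w = (THE n. n \<in> normal_space z p \<and> w - n \<in> tangent_space z p)"

definition second_ff :: "(real \<times> real \<Rightarrow> real^4) \<Rightarrow> (real \<times> real \<Rightarrow> real \<times> real) \<Rightarrow>
    (real \<times> real \<Rightarrow> real \<times> real) \<Rightarrow> real \<times> real \<Rightarrow> real^4" where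
  "second_ff z X Y p = normal_part z p (nabla X (push z Y) p)"

definition normal_conn :: "(real \<times> real \<Rightarrow> real^4) \<Rightarrow> (real \<times> real \<Rightarrow> real \<times> real) \<Rightarrow>
    (real \<times> real \<Rightarrow> real^4) \<Rightarrow> real \<times> real \<Rightarrow> real^4" where
  "normal_conn z X \<xi> p = normal_part z p (nabla X \<xi> p)"

definition EE :: "(real \<times> real \<Rightarrow> real^4) \<Rightarrow> real \<times> real \<Rightarrow> real" where
  "EE z p = mip (d_u z p) (d_u z p)"

definition FF :: "(real \<times> real \<Rightarrow> real^4) \<Rightarrow> real \<times> real \<Rightarrow> real" where
  "FF z p = mip (d_u z p) (d_v z p)"

definition GG :: "(real \<times> real \<Rightarrow> real^4) \<Rightarrow> real \<times> real \<Rightarrow> real" where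
  "GG z p = mip (d_v z p) (d_v z p)"

definition WW :: "(real \<times> real \<Rightarrow> real^4) \<Rightarrow> real \<times> real \<Rightarrow> real" where
  "WW z p = sqrt \<bar>EE z p * GG z p - (FF z p)\<^sup>2\<bar>"

definition lorentz_surface :: "(real \<times> real) set \<Rightarrow> (real \<times> real \<Rightarrow> real^4) \<Rightarrow> bool" where
  "lorentz_surface U z \<longleftrightarrow>
     open U \<and> connected U \<and> U \<noteq> {} \<and> smooth_on U z \<and>
     (\<forall>p\<in>U. inj (frechet_derivative z (at p))) \<and>
     (\<forall>p\<in>U. \<exists>s\<in>tangent_space z p. \<exists>t\<in>tangent_space z p.
        mip s s = 1 \<and> mip t t = -1 \<and> mip s t = 0) \<and>
     (\<forall>p\<in>U. EE z p > 0 \<and> GG z p < 0)"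

section \<open>Mean curvature vector\<close>

text \<open>
  The orthonormal tangent frame obtained from \<open>z\<^sub>u, z\<^sub>v\<close> by the Gram-Schmidt process; for
  \<open>F = 0\<close> it consists of \<open>z\<^sub>u / sqrt E\<close> and \<open>z\<^sub>v / sqrt (-G)\<close>.
\<close>

definition frame1 :: "(real \<times> real \<Rightarrow> real^4) \<Rightarrow> real \<times> real \<Rightarrow> real \<times> real" where
  "frame1 z p = (1 / sqrt (EE z p), 0)"

definition frame2 :: "(real \<times> real \<Rightarrow> real^4) \<Rightarrow> real \<times> real \<Rightarrow> real \<times> real" where
  "frame2 z p = (1 / sqrt ((FF z p)\<^sup>2 / EE z p - GG z p)) *\<^sub>R (- FF z p / EE z p, 1)"

definition mean_curv :: "(real \<times> real \<Rightarrow> real^4) \<Rightarrow> real \<times> real \<Rightarrow> real^4" where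
  "mean_curv z p =
     (1/2) *\<^sub>R (second_ff z (frame1 z) (frame1 z) p - second_ff z (frame2 z) (frame2 z) p)"

section \<open>Surfaces of general type and principal parameters\<close>

definition normal_frame :: "(real \<times> real \<Rightarrow> real^4) \<Rightarrow> real \<times> real \<Rightarrow> real^4 \<Rightarrow> real^4 \<Rightarrow> bool" where
  "normal_frame z p n1 n2 \<longleftrightarrow> n1 \<in> normal_space z p \<and> n2 \<in> normal_space z p \<and>
     mip n1 n1 = 1 \<and> mip n2 n2 = -1 \<and> mip n1 n2 = 0"

definition c11 :: "(real \<times> real \<Rightarrow> real^4) \<Rightarrow> real \<times> real \<Rightarrow> real^4 \<Rightarrow> real" where
  "c11 z p n = mip (d_u (d_u z) p) n"

definition c12 :: "(real \<times> real \<Rightarrow> real^4) \<Rightarrow> real \<times> real \<Rightarrow> real^4 \<Rightarrow> real" where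
  "c12 z p n = mip (d_v (d_u z) p) n"

definition c22 :: "(real \<times> real \<Rightarrow> real^4) \<Rightarrow> real \<times> real \<Rightarrow> real^4 \<Rightarrow> real" where
  "c22 z p n = mip (d_v (d_v z) p) n"

definition Delta1 :: "(real \<times> real \<Rightarrow> real^4) \<Rightarrow> real \<times> real \<Rightarrow> real^4 \<Rightarrow> real^4 \<Rightarrow> real" where
  "Delta1 z p n1 n2 = c11 z p n1 * c12 z p n2 - c12 z p n1 * c11 z p n2"

definition Delta2 :: "(real \<times> real \<Rightarrow> real^4) \<Rightarrow> real \<times> real \<Rightarrow> real^4 \<Rightarrow> real^4 \<Rightarrow> real" where
  "Delta2 z p n1 n2 = c11 z p n1 * c22 z p n2 - c22 z p n1 * c11 z p n2"

definition Delta3 :: "(real \<times> real \<Rightarrow> real^4) \<Rightarrow> real \<times> real \<Rightarrow> real^4 \<Rightarrow> real^4 \<Rightarrow> real" where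
  "Delta3 z p n1 n2 = c12 z p n1 * c22 z p n2 - c22 z p n1 * c12 z p n2"

definition LL :: "(real \<times> real \<Rightarrow> real^4) \<Rightarrow> real \<times> real \<Rightarrow> real^4 \<Rightarrow> real^4 \<Rightarrow> real" where
  "LL z p n1 n2 = 2 * Delta1 z p n1 n2 / WW z p"

definition MM :: "(real \<times> real \<Rightarrow> real^4) \<Rightarrow> real \<times> real \<Rightarrow> real^4 \<Rightarrow> real^4 \<Rightarrow> real" where
  "MM z p n1 n2 = Delta2 z p n1 n2 / WW z p"

definition NN :: "(real \<times> real \<Rightarrow> real^4) \<Rightarrow> real \<times> real \<Rightarrow> real^4 \<Rightarrow> real^4 \<Rightarrow> real" where
  "NN z p n1 n2 = 2 * Delta3 z p n1 n2 / WW z p"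

definition inv_k :: "(real \<times> real \<Rightarrow> real^4) \<Rightarrow> real \<times> real \<Rightarrow> real^4 \<Rightarrow> real^4 \<Rightarrow> real" where
  "inv_k z p n1 n2 = (LL z p n1 n2 * NN z p n1 n2 - (MM z p n1 n2)\<^sup>2)
     / (EE z p * GG z p - (FF z p)\<^sup>2)"

definition inv_kappa :: "(real \<times> real \<Rightarrow> real^4) \<Rightarrow> real \<times> real \<Rightarrow> real^4 \<Rightarrow> real^4 \<Rightarrow> real" where
  "inv_kappa z p n1 n2 =
     (EE z p * NN z p n1 n2 + GG z p * LL z p n1 n2 - 2 * FF z p * MM z p n1 n2)
     / (2 * (EE z p * GG z p - (FF z p)\<^sup>2))"

text \<open>
  Another choice of the normal frame multiplies \<open>L, M, N\<close> by a common sign, so none of the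
  conditions below depends on it; every point of a Lorentz surface admits a normal frame.
\<close>

definition general_type :: "(real \<times> real) set \<Rightarrow> (real \<times> real \<Rightarrow> real^4) \<Rightarrow> bool" where
  "general_type U z \<longleftrightarrow> lorentz_surface U z \<and>
     (\<forall>p\<in>U. \<exists>n1 n2. normal_frame z p n1 n2 \<and>
        (LL z p n1 n2, MM z p n1 n2, NN z p n1 n2) \<noteq> (0, 0, 0) \<and>
        (inv_kappa z p n1 n2)\<^sup>2 - inv_k z p n1 n2 > 0) \<and>
     (\<forall>p\<in>U. mean_curv z p \<noteq> 0 \<and>
        (mip (mean_curv z p) (mean_curv z p) > 0 \<or> mip (mean_curv z p) (mean_curv z p) < 0))"

definition principal_parameters :: "(real \<times> real) set \<Rightarrow> (real \<times> real \<Rightarrow> real^4) \<Rightarrow> bool" where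
  "principal_parameters U z \<longleftrightarrow>
     (\<forall>p\<in>U. FF z p = 0 \<and> (\<exists>n1 n2. normal_frame z p n1 n2 \<and> MM z p n1 n2 = 0))"

section \<open>The geometric frame and the geometric functions\<close>

text \<open>Coordinate fields of \<open>x = z\<^sub>u / sqrt E\<close> and \<open>y = z\<^sub>v / sqrt (-G)\<close>.\<close>

definition x_field :: "(real \<times> real \<Rightarrow> real^4) \<Rightarrow> real \<times> real \<Rightarrow> real \<times> real" where
  "x_field z p = (1 / sqrt (EE z p), 0)"

definition y_field :: "(real \<times> real \<Rightarrow> real^4) \<Rightarrow> real \<times> real \<Rightarrow> real \<times> real" where
  "y_field z p = (0, 1 / sqrt (- GG z p))"

definition eps :: "(real \<times> real \<Rightarrow> real^4) \<Rightarrow> real \<times> real \<Rightarrow> real" where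
  "eps z p = sgn (mip (mean_curv z p) (mean_curv z p))"

definition b_field :: "(real \<times> real \<Rightarrow> real^4) \<Rightarrow> real \<times> real \<Rightarrow> real^4" where
  "b_field z p =
     (eps z p / sqrt (eps z p * mip (mean_curv z p) (mean_curv z p))) *\<^sub>R mean_curv z p"

text \<open>On a surface of general type in principal parameters this determines \<open>l\<close> uniquely on \<open>U\<close>.\<close>

definition is_l_field ::
  "(real \<times> real) set \<Rightarrow> (real \<times> real \<Rightarrow> real^4) \<Rightarrow> (real \<times> real \<Rightarrow> real^4) \<Rightarrow> bool" where
  "is_l_field U z l \<longleftrightarrow> (\<forall>p\<in>U.
     l p \<in> normal_space z p \<and> mip (l p) (l p) = - eps z p \<and> mip (b_field z p) (l p) = 0 \<and>
     (eps z p = 1 \<longrightarrow> pos_oriented (push z (x_field z) p) (push z (y_field z) p) (b_field z p) (l p)) \<and>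
     (eps z p = -1 \<longrightarrow> pos_oriented (push z (x_field z) p) (push z (y_field z) p) (l p) (b_field z p)))"

definition nu1 :: "(real \<times> real \<Rightarrow> real^4) \<Rightarrow> real \<times> real \<Rightarrow> real" where
  "nu1 z p = mip (second_ff z (x_field z) (x_field z) p) (b_field z p)"

definition nu2 :: "(real \<times> real \<Rightarrow> real^4) \<Rightarrow> real \<times> real \<Rightarrow> real" where
  "nu2 z p = mip (second_ff z (y_field z) (y_field z) p) (b_field z p)"

definition beta1 :: "(real \<times> real \<Rightarrow> real^4) \<Rightarrow> (real \<times> real \<Rightarrow> real^4) \<Rightarrow> real \<times> real \<Rightarrow> real" where
  "beta1 z l p = mip (nabla (x_field z) (b_field z) p) (l p)"

definition beta2 :: "(real \<times> real \<Rightarrow> real^4) \<Rightarrow> (real \<times> real \<Rightarrow> real^4) \<Rightarrow> real \<times> real \<Rightarrow> real" where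
  "beta2 z l p = mip (nabla (y_field z) (b_field z) p) (l p)"

definition parallel_mean_curv :: "(real \<times> real) set \<Rightarrow> (real \<times> real \<Rightarrow> real^4) \<Rightarrow> bool" where
  "parallel_mean_curv U z \<longleftrightarrow> (\<forall>X. \<forall>p\<in>U. normal_conn z X (mean_curv z) p = 0)"

end

theory Submission
  imports Defs
begin

text \<open>
  Write \<open>q = \<langle>H,H\<rangle>\<close> and \<open>h = sqrt \<bar>q\<bar>\<close>. By the definition of \<open>b\<close>,
  \<open>\<langle>H,b\<rangle> = h\<close>, and since \<open>2 H = \<sigma>(x,x) - \<sigma>(y,y)\<close> this says \<open>\<nu>\<^sub>1 - \<nu>\<^sub>2 = 2 h\<close>
  (\<open>nu_diff_eq\<close>). The sign of \<open>q\<close> cannot change on the connected set \<open>U\<close>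
  (\<open>eps_constant\<close>), so \<open>\<nu>\<^sub>1 - \<nu>\<^sub>2\<close> is constant exactly when \<open>q\<close> is.

  At each point the normal vectors \<open>b, l\<close> complete the tangent frame to a basis of the ambient
  space, so a vector is tangent iff it is orthogonal to \<open>b\<close> and \<open>l\<close>
  (\<open>normal_part_zero_iff\<close>). Hence \<open>DH = 0\<close> means that every derivative \<open>dH\<close> satisfies
  \<open>\<langle>dH,H\<rangle> = 0\<close>, that is, \<open>q\<close> is constant
  (\<open>mean_curv_square_constant_iff\<close>), and \<open>\<langle>dH,l\<rangle> = 0\<close>. In either direction of the
  equivalence \<open>q\<close> is constant; then \<open>b = c H\<close> with one constant \<open>c \<noteq> 0\<close>
  (\<open>b_field_constant_multiple\<close>), and \<open>\<langle>db,l\<rangle> = c \<langle>dH,l\<rangle>\<close>, so that \<open>\<langle>dH,l\<rangle> = 0\<close> is the same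
  as \<open>\<beta>\<^sub>1 = \<beta>\<^sub>2 = 0\<close>. The one analytic point is that \<open>H\<close> is differentiable
  (\<open>mean_curv_differentiable\<close>), for which \<open>H\<close> is computed explicitly from the
  second derivatives of \<open>z\<close>.
\<close>

section \<open>The ambient metric\<close>

lemma bounded_bilinear_mip: "bounded_bilinear mip"
  unfolding bilinear_conv_bounded_bilinear[symmetric] bilinear_def
  by (auto intro!: linearI simp: mip_def algebra_simps)

interpretation mip: bounded_bilinear mip
  by (rule bounded_bilinear_mip)

lemma mip_commute: "mip a b = mip b a"
  by (simp add: mip_def algebra_simps)

lemma mip_scaleR: "mip (r *\<^sub>R a) b = r * mip a b" "mip a (r *\<^sub>R b) = r * mip a b"
  by (simp_all add: mip.scaleR_left mip.scaleR_right)

text \<open>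
  Up to the signs of two coordinates of \<open>n\<close>, the products \<open>mip n a, ..., mip n d\<close> are the entries
  of the matrix with rows \<open>a, b, c, d\<close> applied to \<open>n\<close>, and this matrix is invertible.
\<close>
lemma mip_zero_of_det_nonzero:
  assumes "det (vector [a, b, c, d] :: real^4^4) \<noteq> 0"
    and "mip n a = 0" "mip n b = 0" "mip n c = 0" "mip n d = 0"
  shows "n = 0"
proof -
  let ?A = "vector [a, b, c, d] :: real^4^4"
  let ?m = "vector [n$1, n$2, - n$3, - n$4] :: real^4"
  have rows: "(vector [s, t, u, v] :: 'b::zero^4) $ 1 = s"
    "(vector [s, t, u, v] :: 'b::zero^4) $ 2 = t"
    "(vector [s, t, u, v] :: 'b::zero^4) $ 3 = u"
    "(vector [s, t, u, v] :: 'b::zero^4) $ 4 = v" for s t u v :: "'b::zero"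
    by (simp_all add: vector_def)
  have "?A *v ?m = 0"
    using assms(2-5)
    by (simp add: vec_eq_iff forall_4 matrix_vector_mult_def sum_4 rows mip_def algebra_simps)
  moreover have "\<exists>B. B ** ?A = mat 1"
    using assms(1) by (meson invertible_det_nz invertible_def)
  ultimately have "?m = 0"
    by (metis matrix_left_invertible_ker)
  then show ?thesis
    by (simp add: vec_eq_iff forall_4 rows)
qed

section \<open>Differentiation in the parameter plane\<close>

lemma frechet_derivative_pair:
  assumes "f differentiable (at p)"
  shows "frechet_derivative f (at p) (r, s) = r *\<^sub>R d_u f p + s *\<^sub>R d_v f p"
proof -
  interpret D: linear "frechet_derivative f (at p)"
    using assms by (rule linear_frechet_derivative)
  have "(r, s) = r *\<^sub>R (1, 0) + s *\<^sub>R (0, 1)" by simp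
  then show ?thesis
    unfolding d_u_def d_v_def by (metis D.add D.scale)
qed

lemma Ck_on_3_differentiable:
  assumes "Ck_on 3 U f" "p \<in> U"
  shows "f differentiable (at p)" "d_u f differentiable (at p)" "d_v f differentiable (at p)"
    "d_u (d_u f) differentiable (at p)" "d_v (d_v f) differentiable (at p)"
  using assms by (simp_all add: numeral_3_eq_3)

lemma differentiable_mip:
  assumes "f differentiable (at p)" "g differentiable (at p)"
  shows "(\<lambda>q. mip (f q) (g q)) differentiable (at p)"
  using assms mip.FDERIV unfolding differentiable_def by blast

lemma differentiable_inverse_sqrt:
  fixes f :: "real \<times> real \<Rightarrow> real"
  assumes "f differentiable (at p)" "f p > 0"
  shows "(\<lambda>q. 1 / sqrt (f q)) differentiable (at p)"
proof -
  have "(f has_derivative frechet_derivative f (at p)) (at p)"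
    using assms(1) by (simp add: frechet_derivative_works)
  from has_derivative_real_sqrt[OF assms(2) this]
  have "(\<lambda>q. sqrt (f q)) differentiable (at p)"
    unfolding differentiable_def by blast
  then show ?thesis
    using assms(2) by (intro differentiable_divide differentiable_const) simp_all
qed

lemma inverse_sqrt_squared: "a > 0 \<Longrightarrow> 1 / sqrt a * (1 / sqrt a) = 1 / (a::real)"
  by simp

section \<open>Orthogonal charts\<close>

locale orthogonal_chart =
  fixes U :: "(real \<times> real) set" and z :: "real \<times> real \<Rightarrow> real^4"
  assumes lorentz: "lorentz_surface U z"
    and orthogonal: "p \<in> U \<Longrightarrow> FF z p = 0"
begin

lemma open_U: "open U" and connected_U: "connected U"
  using lorentz by (simp_all add: lorentz_surface_def)

lemma EE_pos: "p \<in> U \<Longrightarrow> EE z p > 0" and GG_neg: "p \<in> U \<Longrightarrow> GG z p < 0"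
  using lorentz by (simp_all add: lorentz_surface_def)

lemma chart_differentiable:
  assumes "p \<in> U"
  shows "z differentiable (at p)" "d_u z differentiable (at p)" "d_v z differentiable (at p)"
    "d_u (d_u z) differentiable (at p)" "d_v (d_v z) differentiable (at p)"
proof -
  have "Ck_on 3 U z"
    using lorentz unfolding lorentz_surface_def smooth_on_def by blast
  from Ck_on_3_differentiable[OF this assms]
  show "z differentiable (at p)" "d_u z differentiable (at p)" "d_v z differentiable (at p)"
    "d_u (d_u z) differentiable (at p)" "d_v (d_v z) differentiable (at p)" .
qed

lemma tangent_space_eq:
  assumes "p \<in> U"
  shows "tangent_space z p = {r *\<^sub>R d_u z p + s *\<^sub>R d_v z p | r s. True}"
  using frechet_derivative_pair[OF chart_differentiable(1)[OF assms]]
  unfolding tangent_space_def by (force simp: image_iff)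

lemma normal_space_iff:
  assumes "p \<in> U"
  shows "n \<in> normal_space z p \<longleftrightarrow> mip n (d_u z p) = 0 \<and> mip n (d_v z p) = 0"
proof
  assume "n \<in> normal_space z p"
  then have "mip n (r *\<^sub>R d_u z p + s *\<^sub>R d_v z p) = 0" for r s
    unfolding normal_space_def tangent_space_eq[OF assms] by blast
  from this[of 1 0] this[of 0 1] show "mip n (d_u z p) = 0 \<and> mip n (d_v z p) = 0"
    by simp
next
  assume "mip n (d_u z p) = 0 \<and> mip n (d_v z p) = 0"
  then show "n \<in> normal_space z p"
    unfolding normal_space_def tangent_space_eq[OF assms]
    by (auto simp: mip.add_right mip_scaleR)
qed

lemma mip_coordinate_fields:
  assumes "p \<in> U"
  shows "mip (d_u z p) (d_u z p) = EE z p" "mip (d_v z p) (d_v z p) = GG z p"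
    "mip (d_u z p) (d_v z p) = 0" "mip (d_v z p) (d_u z p) = 0"
  using orthogonal[OF assms] by (simp_all add: EE_def GG_def FF_def mip_commute)

text \<open>
  Orthogonal projection along the tangent plane, whose basis \<open>z\<^sub>u, z\<^sub>v\<close> is orthogonal because
  \<open>F = 0\<close>; the normal part is unique because the plane is non-degenerate.
\<close>
lemma normal_part_eq:
  assumes p: "p \<in> U"
  shows "normal_part z p w = w - (mip w (d_u z p) / EE z p) *\<^sub>R d_u z p
    - (mip w (d_v z p) / GG z p) *\<^sub>R d_v z p"
  unfolding normal_part_def
proof (rule the_equality)
  let ?n = "w - (mip w (d_u z p) / EE z p) *\<^sub>R d_u z p
    - (mip w (d_v z p) / GG z p) *\<^sub>R d_v z p"
  note [simp] = mip.diff_left mip.add_left mip_scaleR mip_coordinate_fields[OF p]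
  have nz: "EE z p \<noteq> 0" "GG z p \<noteq> 0"
    using EE_pos[OF p] GG_neg[OF p] by auto
  have "w - ?n = (mip w (d_u z p) / EE z p) *\<^sub>R d_u z p
    + (mip w (d_v z p) / GG z p) *\<^sub>R d_v z p"
    by simp
  then show "?n \<in> normal_space z p \<and> w - ?n \<in> tangent_space z p"
    unfolding normal_space_iff[OF p] tangent_space_eq[OF p] using nz by auto
  fix n assume n: "n \<in> normal_space z p \<and> w - n \<in> tangent_space z p"
  then obtain r s where rs: "w - n = r *\<^sub>R d_u z p + s *\<^sub>R d_v z p"
    unfolding tangent_space_eq[OF p] by auto
  then have w: "w = n + r *\<^sub>R d_u z p + s *\<^sub>R d_v z p"
    by (simp add: algebra_simps)
  have "mip w (d_u z p) = r * EE z p" "mip w (d_v z p) = s * GG z p"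
    using n unfolding w normal_space_iff[OF p] by auto
  then show "n = ?n"
    using nz w by simp
qed

lemma normal_part_in_normal_space:
  assumes p: "p \<in> U"
  shows "normal_part z p w \<in> normal_space z p"
  using EE_pos[OF p] GG_neg[OF p]
  by (simp add: normal_part_eq[OF p] normal_space_iff[OF p] mip.diff_left mip_scaleR
      mip_coordinate_fields[OF p])

lemma mip_normal_part:
  assumes "p \<in> U" "n \<in> normal_space z p"
  shows "mip (normal_part z p w) n = mip w n"
proof -
  have "mip (d_u z p) n = 0" "mip (d_v z p) n = 0"
    using assms normal_space_iff mip_commute by metis+
  then show ?thesis
    by (simp add: normal_part_eq[OF assms(1)] mip.diff_left mip_scaleR)
qed

text \<open>
  Differentiating the coefficient of a rescaled tangent field only adds a tangent term, so the
  second fundamental form may be computed from the unscaled coordinate fields.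
\<close>
lemma normal_part_nabla_scaleR:
  assumes p: "p \<in> U"
    and g: "g differentiable (at p)" and e: "e differentiable (at p)"
    and tangent: "e p = d_u z p \<or> e p = d_v z p"
    and Y: "\<And>q. q \<in> U \<Longrightarrow> Y q = g q *\<^sub>R e q"
  shows "normal_part z p (nabla X Y p) =
    g p *\<^sub>R normal_part z p (frechet_derivative e (at p) (X p))"
proof -
  let ?g = "frechet_derivative g (at p)" and ?e = "frechet_derivative e (at p)"
  have "((\<lambda>q. g q *\<^sub>R e q) has_derivative (\<lambda>h. g p *\<^sub>R ?e h + ?g h *\<^sub>R e p)) (at p)"
    using g e by (intro has_derivative_scaleR) (simp_all add: frechet_derivative_works)
  then have "(Y has_derivative (\<lambda>h. g p *\<^sub>R ?e h + ?g h *\<^sub>R e p)) (at p)"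
    by (rule has_derivative_transform_within_open[OF _ open_U p]) (simp add: Y)
  then have "frechet_derivative Y (at p) = (\<lambda>h. g p *\<^sub>R ?e h + ?g h *\<^sub>R e p)"
    by (rule frechet_derivative_at[symmetric])
  then have "nabla X Y p = g p *\<^sub>R ?e (X p) + ?g (X p) *\<^sub>R e p"
    by (simp add: nabla_def)
  moreover have "normal_part z p (a *\<^sub>R v + c *\<^sub>R e p) = a *\<^sub>R normal_part z p v" for a c v
    using tangent EE_pos[OF p] GG_neg[OF p]
    by (auto simp: normal_part_eq[OF p] mip.add_left mip_scaleR mip_coordinate_fields[OF p]
        algebra_simps add_divide_distrib)
  ultimately show ?thesis by simp
qed

lemma EE_GG_differentiable:
  assumes "p \<in> U"
  shows "EE z differentiable (at p)" "GG z differentiable (at p)"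
  using differentiable_mip[OF chart_differentiable(2,2)[OF assms]]
    differentiable_mip[OF chart_differentiable(3,3)[OF assms]]
  unfolding EE_def[abs_def] GG_def[abs_def] by simp_all

lemma normal_part_scaleR:
  assumes "p \<in> U"
  shows "normal_part z p (r *\<^sub>R w) = r *\<^sub>R normal_part z p w"
  by (simp add: normal_part_eq[OF assms] mip_scaleR scaleR_diff_right)

lemma second_ff_x_eq:
  assumes p: "p \<in> U"
  shows "second_ff z (x_field z) (x_field z) p
    = (1 / EE z p) *\<^sub>R normal_part z p (d_u (d_u z) p)"
proof -
  let ?r = "1 / sqrt (EE z p)"
  have "second_ff z (x_field z) (x_field z) p =
      ?r *\<^sub>R normal_part z p (frechet_derivative (d_u z) (at p) (x_field z p))"
    unfolding second_ff_def
  proof (rule normal_part_nabla_scaleR[OF p])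
    show "(\<lambda>q. 1 / sqrt (EE z q)) differentiable (at p)"
      by (intro differentiable_inverse_sqrt EE_GG_differentiable p EE_pos)
    show "push z (x_field z) q = (1 / sqrt (EE z q)) *\<^sub>R d_u z q" if "q \<in> U" for q
      using frechet_derivative_pair[OF chart_differentiable(1)[OF that]]
      by (simp add: push_def x_field_def)
  qed (simp_all add: chart_differentiable p)
  also have "frechet_derivative (d_u z) (at p) (x_field z p) = ?r *\<^sub>R d_u (d_u z) p"
    using frechet_derivative_pair[OF chart_differentiable(2)[OF p]] by (simp add: x_field_def)
  finally have "second_ff z (x_field z) (x_field z) p =
      (?r * ?r) *\<^sub>R normal_part z p (d_u (d_u z) p)"
    by (simp only: normal_part_scaleR[OF p] scaleR_scaleR)
  also have "?r * ?r = 1 / EE z p"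
    using EE_pos[OF p] by (rule inverse_sqrt_squared)
  finally show ?thesis .
qed

text \<open>
  Since \<open>\<sigma>\<close> differentiates its second argument, a field must agree with \<open>y\<close> on the open set \<open>U\<close>,
  not only at \<open>p\<close>. The freedom in \<open>Y\<close> admits both \<open>y\<close> and the Gram-Schmidt field.
\<close>
lemma second_ff_y_eq:
  assumes p: "p \<in> U" and Y: "\<And>q. q \<in> U \<Longrightarrow> Y q = y_field z q"
  shows "second_ff z Y Y p = (- 1 / GG z p) *\<^sub>R normal_part z p (d_v (d_v z) p)"
proof -
  let ?r = "1 / sqrt (- GG z p)"
  have "second_ff z Y Y p = ?r *\<^sub>R normal_part z p (frechet_derivative (d_v z) (at p) (Y p))"
    unfolding second_ff_def
  proof (rule normal_part_nabla_scaleR[OF p])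
    show "(\<lambda>q. 1 / sqrt (- GG z q)) differentiable (at p)"
      using GG_neg[OF p]
      by (intro differentiable_inverse_sqrt differentiable_minus EE_GG_differentiable p) simp
    show "push z Y q = (1 / sqrt (- GG z q)) *\<^sub>R d_v z q" if "q \<in> U" for q
      using frechet_derivative_pair[OF chart_differentiable(1)[OF that]]
      by (simp add: push_def Y[OF that] y_field_def)
  qed (simp_all add: chart_differentiable p)
  also have "frechet_derivative (d_v z) (at p) (Y p) = ?r *\<^sub>R d_v (d_v z) p"
    using frechet_derivative_pair[OF chart_differentiable(3)[OF p]]
    by (simp add: Y[OF p] y_field_def)
  finally have "second_ff z Y Y p = (?r * ?r) *\<^sub>R normal_part z p (d_v (d_v z) p)"
    by (simp only: normal_part_scaleR[OF p] scaleR_scaleR)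
  also have "?r * ?r = - 1 / GG z p"
    using inverse_sqrt_squared[of "- GG z p"] GG_neg[OF p] by simp
  finally show ?thesis .
qed

section \<open>The mean curvature vector\<close>

lemma mean_curv_eq_second_ff:
  assumes p: "p \<in> U"
  shows "mean_curv z p = (1/2) *\<^sub>R (second_ff z (x_field z) (x_field z) p
    - second_ff z (y_field z) (y_field z) p)"
proof -
  have "frame1 z = x_field z"
    by (simp add: fun_eq_iff frame1_def x_field_def)
  moreover have "frame2 z q = y_field z q" if "q \<in> U" for q
    using orthogonal[OF that] by (simp add: frame2_def y_field_def)
  then have "second_ff z (frame2 z) (frame2 z) p = second_ff z (y_field z) (y_field z) p"
    by (simp only: second_ff_y_eq[OF p])
  ultimately show ?thesis
    by (simp add: mean_curv_def)
qed

lemma mean_curv_eq: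
  assumes p: "p \<in> U"
  shows "mean_curv z p = (1/2) *\<^sub>R ((1 / EE z p) *\<^sub>R normal_part z p (d_u (d_u z) p)
    + (1 / GG z p) *\<^sub>R normal_part z p (d_v (d_v z) p))"
  using mean_curv_eq_second_ff[OF p] second_ff_x_eq[OF p] second_ff_y_eq[OF p] by simp

lemma mean_curv_normal:
  assumes p: "p \<in> U"
  shows "mean_curv z p \<in> normal_space z p"
  using normal_part_in_normal_space[OF p]
  by (simp add: mean_curv_eq[OF p] normal_space_iff[OF p] mip.add_left mip_scaleR)

lemma mean_curv_differentiable:
  assumes p: "p \<in> U"
  shows "mean_curv z differentiable (at p)"
proof -
  define P where "P w q = w q - (mip (w q) (d_u z q) / EE z q) *\<^sub>R d_u z q
    - (mip (w q) (d_v z q) / GG z q) *\<^sub>R d_v z q" for w q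
  have nz: "EE z p \<noteq> 0" "GG z p \<noteq> 0"
    using EE_pos[OF p] GG_neg[OF p] by auto
  have P: "P w differentiable (at p)" if "w differentiable (at p)" for w
    unfolding P_def[abs_def] using nz
    by (intro differentiable_diff differentiable_scaleR differentiable_divide differentiable_mip
        that chart_differentiable EE_GG_differentiable p)
  have "(\<lambda>q. (1/2) *\<^sub>R ((1 / EE z q) *\<^sub>R P (d_u (d_u z)) q + (1 / GG z q) *\<^sub>R P (d_v (d_v z)) q))
      differentiable (at p)"
    using nz
    by (intro differentiable_add differentiable_scaleR differentiable_divide differentiable_const
        P chart_differentiable EE_GG_differentiable p)
  then obtain D where D: "((\<lambda>q. (1/2) *\<^sub>R ((1 / EE z q) *\<^sub>R P (d_u (d_u z)) q
      + (1 / GG z q) *\<^sub>R P (d_v (d_v z)) q)) has_derivative D) (at p)"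
    by (auto simp: differentiable_def)
  have "(mean_curv z has_derivative D) (at p)"
    by (rule has_derivative_transform_within_open[OF D open_U p])
      (simp only: mean_curv_eq normal_part_eq P_def)
  then show ?thesis
    by (auto simp: differentiable_def)
qed

lemma mean_curv_square_has_derivative:
  assumes "p \<in> U"
  shows "((\<lambda>q. mip (mean_curv z q) (mean_curv z q)) has_derivative
    (\<lambda>h. 2 * mip (frechet_derivative (mean_curv z) (at p) h) (mean_curv z p))) (at p)"
proof -
  have "(mean_curv z has_derivative frechet_derivative (mean_curv z) (at p)) (at p)"
    using mean_curv_differentiable[OF assms] by (simp add: frechet_derivative_works)
  from mip.FDERIV[OF this this] show ?thesis
    unfolding mip_commute[of "mean_curv z p" "frechet_derivative (mean_curv z) (at p) _"]
      mult_2 .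
qed

end

section \<open>The frame of the normal plane\<close>

locale framed_chart = orthogonal_chart +
  fixes l :: "real \<times> real \<Rightarrow> real^4"
  assumes mean_curv_nonnull: "p \<in> U \<Longrightarrow> mip (mean_curv z p) (mean_curv z p) \<noteq> 0"
    and l_field: "is_l_field U z l"
begin

lemma b_field_nonzero_multiple:
  assumes "p \<in> U"
  shows "eps z p / sqrt (eps z p * mip (mean_curv z p) (mean_curv z p)) \<noteq> 0"
  using mean_curv_nonnull[OF assms] by (simp add: eps_def sgn_if)

text \<open>
  The orientation condition on \<open>l\<close> makes \<open>x, y, b, l\<close> a basis, so a normal vector orthogonal to
  both \<open>H\<close> and \<open>l\<close> is orthogonal to everything.
\<close>
lemma normal_part_zero_iff:
  assumes p: "p \<in> U"
  shows "normal_part z p w = 0 \<longleftrightarrow> mip w (mean_curv z p) = 0 \<and> mip w (l p) = 0"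
proof
  assume "normal_part z p w = 0"
  moreover have "l p \<in> normal_space z p"
    using l_field p by (simp add: is_l_field_def)
  ultimately show "mip w (mean_curv z p) = 0 \<and> mip w (l p) = 0"
    using mip_normal_part[OF p] mean_curv_normal[OF p] mip.zero_left by metis
next
  assume w: "mip w (mean_curv z p) = 0 \<and> mip w (l p) = 0"
  let ?n = "normal_part z p w"
  have lp: "l p \<in> normal_space z p"
    using l_field p by (simp add: is_l_field_def)
  have nl: "mip ?n (l p) = 0" and nb: "mip ?n (b_field z p) = 0"
    using w by (simp_all add: mip_normal_part[OF p] lp mean_curv_normal[OF p] b_field_def mip_scaleR)
  have "push z (X z) p \<in> tangent_space z p" for X
    by (simp add: push_def tangent_space_def)
  then have nx: "mip ?n (push z (x_field z) p) = 0" and ny: "mip ?n (push z (y_field z) p) = 0"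
    using normal_part_in_normal_space[OF p] unfolding normal_space_def by blast+
  have "eps z p = 1 \<or> eps z p = -1"
    using mean_curv_nonnull[OF p] by (simp add: eps_def sgn_if)
  then show "?n = 0"
  proof
    assume "eps z p = 1"
    then have "det (vector [push z (x_field z) p, push z (y_field z) p, b_field z p, l p]
        :: real^4^4) \<noteq> 0"
      using l_field p unfolding is_l_field_def pos_oriented_def by fastforce
    from mip_zero_of_det_nonzero[OF this nx ny nb nl] show ?thesis .
  next
    assume "eps z p = -1"
    then have "det (vector [push z (x_field z) p, push z (y_field z) p, l p, b_field z p]
        :: real^4^4) \<noteq> 0"
      using l_field p unfolding is_l_field_def pos_oriented_def by fastforce
    from mip_zero_of_det_nonzero[OF this nx ny nl nb] show ?thesis .
  qed
qed

lemma nu_diff_eq: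
  assumes p: "p \<in> U"
  shows "nu1 z p - nu2 z p = 2 * sqrt (eps z p * mip (mean_curv z p) (mean_curv z p))"
proof -
  let ?q = "mip (mean_curv z p) (mean_curv z p)"
  have "nu1 z p - nu2 z p = 2 * mip (mean_curv z p) (b_field z p)"
    by (simp add: nu1_def nu2_def mean_curv_eq_second_ff[OF p] mip_scaleR mip.diff_left)
  also have "\<dots> = 2 * ((eps z p * ?q) / sqrt (eps z p * ?q))"
    by (simp add: b_field_def mip_scaleR)
  also have "(eps z p * ?q) / sqrt (eps z p * ?q) = sqrt (eps z p * ?q)"
    by (rule real_div_sqrt) (simp add: eps_def sgn_if)
  finally show ?thesis .
qed

lemma eps_constant: "eps z constant_on U"
proof -
  have "continuous_on U (\<lambda>p. mip (mean_curv z p) (mean_curv z p))"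
    using mean_curv_square_has_derivative
    by (intro continuous_at_imp_continuous_on) (blast intro: has_derivative_continuous)
  then have "continuous_on U (eps z)"
    unfolding eps_def[abs_def] using mean_curv_nonnull by (intro continuous_on_sgn) auto
  moreover have "finite (eps z ` U)"
    by (rule finite_subset[of _ "{-1, 0, 1}"]) (auto simp: eps_def sgn_if)
  ultimately show ?thesis
    using connected_U by (intro continuous_finite_range_constant) auto
qed

lemma nu_diff_constant_iff:
  "(\<lambda>p. nu1 z p - nu2 z p) constant_on U \<longleftrightarrow>
   (\<lambda>p. mip (mean_curv z p) (mean_curv z p)) constant_on U"
proof -
  let ?q = "\<lambda>p. mip (mean_curv z p) (mean_curv z p)"
  obtain e where e: "eps z p = e" if "p \<in> U" for p
    using eps_constant by (auto simp: constant_on_def)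
  have nu: "nu1 z p - nu2 z p = 2 * sqrt (e * ?q p)" if "p \<in> U" for p
    using nu_diff_eq e that by simp
  have q: "?q p = e * ((nu1 z p - nu2 z p) / 2)\<^sup>2" if "p \<in> U" for p
  proof -
    have "e * ?q p \<ge> 0" "e * e = 1"
      using mean_curv_nonnull[OF that] unfolding e[OF that, symmetric] eps_def
      by (simp_all add: sgn_if)
    then show ?thesis
      by (simp add: nu[OF that] flip: mult.assoc)
  qed
  show ?thesis
  proof
    assume "(\<lambda>p. nu1 z p - nu2 z p) constant_on U"
    then obtain c where "\<forall>p\<in>U. nu1 z p - nu2 z p = c"
      by (auto simp: constant_on_def)
    then have "\<forall>p\<in>U. ?q p = e * (c / 2)\<^sup>2"
      using q by simp
    then show "?q constant_on U"
      by (auto simp: constant_on_def)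
  next
    assume "?q constant_on U"
    then obtain c where "\<forall>p\<in>U. ?q p = c"
      by (auto simp: constant_on_def)
    then have "\<forall>p\<in>U. nu1 z p - nu2 z p = 2 * sqrt (e * c)"
      using nu by simp
    then show "(\<lambda>p. nu1 z p - nu2 z p) constant_on U"
      by (auto simp: constant_on_def)
  qed
qed

lemma b_field_constant_multiple:
  assumes "(\<lambda>p. mip (mean_curv z p) (mean_curv z p)) constant_on U"
  obtains c where "c \<noteq> 0" "\<And>p. p \<in> U \<Longrightarrow> b_field z p = c *\<^sub>R mean_curv z p"
proof -
  obtain p0 where p0: "p0 \<in> U"
    using lorentz by (auto simp: lorentz_surface_def)
  obtain e where e: "eps z p = e" if "p \<in> U" for p
    using eps_constant by (auto simp: constant_on_def)
  obtain q where q: "mip (mean_curv z p) (mean_curv z p) = q" if "p \<in> U" for p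
    using assms by (auto simp: constant_on_def)
  show ?thesis
  proof (rule that[of "e / sqrt (e * q)"])
    show "e / sqrt (e * q) \<noteq> 0"
      using b_field_nonzero_multiple[OF p0] p0 by (simp only: e q not_False_eq_True)
    show "b_field z p = (e / sqrt (e * q)) *\<^sub>R mean_curv z p" if "p \<in> U" for p
      using that by (simp only: b_field_def e q)
  qed
qed

text \<open>
  With \<open>\<langle>H,H\<rangle>\<close> constant, \<open>b\<close> and \<open>H\<close> differ by a constant factor and so do their derivatives;
  the directions \<open>x, y\<close> span the parameter plane.
\<close>
lemma beta_zero_iff:
  assumes const: "(\<lambda>p. mip (mean_curv z p) (mean_curv z p)) constant_on U" and p: "p \<in> U"
  shows "beta1 z l p = 0 \<and> beta2 z l p = 0 \<longleftrightarrow>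
    (\<forall>h. mip (frechet_derivative (mean_curv z) (at p) h) (l p) = 0)"
proof -
  let ?H = "mean_curv z"
  obtain c where c: "c \<noteq> 0" "\<And>q. q \<in> U \<Longrightarrow> b_field z q = c *\<^sub>R ?H q"
    using b_field_constant_multiple[OF const] by blast
  have "(?H has_derivative frechet_derivative ?H (at p)) (at p)"
    using mean_curv_differentiable[OF p] by (simp add: frechet_derivative_works)
  then have "((\<lambda>q. c *\<^sub>R ?H q) has_derivative (\<lambda>h. c *\<^sub>R frechet_derivative ?H (at p) h)) (at p)"
    by (rule has_derivative_scaleR_right)
  then have "(b_field z has_derivative (\<lambda>h. c *\<^sub>R frechet_derivative ?H (at p) h)) (at p)"
    by (rule has_derivative_transform_within_open[OF _ open_U p]) (simp add: c)
  then have b': "frechet_derivative (b_field z) (at p) = (\<lambda>h. c *\<^sub>R frechet_derivative ?H (at p) h)"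
    by (rule frechet_derivative_at[symmetric])
  note pair = frechet_derivative_pair[OF mean_curv_differentiable[OF p]]
  have "beta1 z l p = (c / sqrt (EE z p)) * mip (d_u ?H p) (l p)"
    "beta2 z l p = (c / sqrt (- GG z p)) * mip (d_v ?H p) (l p)"
    by (simp_all add: beta1_def beta2_def nabla_def b' x_field_def y_field_def pair mip_scaleR)
  then have "beta1 z l p = 0 \<and> beta2 z l p = 0 \<longleftrightarrow>
      mip (d_u ?H p) (l p) = 0 \<and> mip (d_v ?H p) (l p) = 0"
    using c(1) EE_pos[OF p] GG_neg[OF p] by simp
  also have "\<dots> \<longleftrightarrow> (\<forall>h. mip (frechet_derivative ?H (at p) h) (l p) = 0)"
  proof
    assume "mip (d_u ?H p) (l p) = 0 \<and> mip (d_v ?H p) (l p) = 0"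
    then show "\<forall>h. mip (frechet_derivative ?H (at p) h) (l p) = 0"
      by (simp add: pair mip.add_left mip_scaleR)
  qed (simp add: d_u_def d_v_def)
  finally show ?thesis .
qed

lemma mean_curv_square_constant_iff:
  "(\<lambda>p. mip (mean_curv z p) (mean_curv z p)) constant_on U \<longleftrightarrow>
   (\<forall>p\<in>U. \<forall>h. mip (frechet_derivative (mean_curv z) (at p) h) (mean_curv z p) = 0)"
    (is "?q constant_on U \<longleftrightarrow> _")
proof
  assume "?q constant_on U"
  then obtain c where c: "?q p = c" if "p \<in> U" for p
    by (auto simp: constant_on_def)
  show "\<forall>p\<in>U. \<forall>h. mip (frechet_derivative (mean_curv z) (at p) h) (mean_curv z p) = 0"
  proof (intro ballI allI)
    fix p h assume p: "p \<in> U"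
    have "(?q has_derivative (\<lambda>h. 0)) (at p)"
      by (rule has_derivative_transform_within_open[OF has_derivative_const[of c] open_U p])
        (simp add: c)
    then have "(\<lambda>h. 2 * mip (frechet_derivative (mean_curv z) (at p) h) (mean_curv z p)) = (\<lambda>h. 0)"
      using mean_curv_square_has_derivative[OF p] by (rule has_derivative_unique[rotated])
    then show "mip (frechet_derivative (mean_curv z) (at p) h) (mean_curv z p) = 0"
      by (auto dest: fun_cong[of _ _ h])
  qed
next
  assume zero: "\<forall>p\<in>U. \<forall>h. mip (frechet_derivative (mean_curv z) (at p) h) (mean_curv z p) = 0"
  show "?q constant_on U"
  proof -
    have "(?q has_derivative (\<lambda>h. 0)) (at p)" if "p \<in> U" for p
      using mean_curv_square_has_derivative[OF that] zero that by simp
    then have "?q p = ?q p'" if "p \<in> U" "p' \<in> U" for p p'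
      using has_derivative_zero_unique_connected[OF open_U connected_U] that by blast
    then show ?thesis
      unfolding constant_on_def by blast
  qed
qed

lemma parallel_mean_curv_iff:
  "parallel_mean_curv U z \<longleftrightarrow> (\<forall>p\<in>U. \<forall>h.
     mip (frechet_derivative (mean_curv z) (at p) h) (mean_curv z p) = 0 \<and>
     mip (frechet_derivative (mean_curv z) (at p) h) (l p) = 0)"
proof -
  let ?N = "\<lambda>p h. normal_part z p (frechet_derivative (mean_curv z) (at p) h)"
  have "parallel_mean_curv U z \<longleftrightarrow> (\<forall>X. \<forall>p\<in>U. ?N p (X p) = 0)"
    by (simp add: parallel_mean_curv_def normal_conn_def nabla_def)
  also have "\<dots> \<longleftrightarrow> (\<forall>p\<in>U. \<forall>h. ?N p h = 0)"
  proof
    assume X: "\<forall>X. \<forall>p\<in>U. ?N p (X p) = 0"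
    show "\<forall>p\<in>U. \<forall>h. ?N p h = 0"
      using X[rule_format, of _ "\<lambda>_. h" for h] by blast
  qed blast
  finally show ?thesis
    by (simp add: normal_part_zero_iff)
qed

end

theorem proposition5p6:
  fixes U :: "(real \<times> real) set"
    and z l :: "real \<times> real \<Rightarrow> real^4"
  assumes "general_type U z"
    and "principal_parameters U z"
    and "is_l_field U z l"
  shows "parallel_mean_curv U z \<longleftrightarrow>
    (\<forall>p\<in>U. beta1 z l p = 0 \<and> beta2 z l p = 0) \<and>
    (\<lambda>p. nu1 z p - nu2 z p) constant_on U"
proof -
  interpret framed_chart U z l
    using assms unfolding general_type_def principal_parameters_def
    by unfold_locales force+
  show ?thesis
    unfolding parallel_mean_curv_iff nu_diff_constant_iff
    using mean_curv_square_constant_iff beta_zero_iff by blast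
qed

end
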